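(* For $d,n\in\mathbf N$ and $\mu\in\mathcal P_n$ one has $$ e_d\, s_\mu=\sum_{\lambda\in\mathcal P_{n+d}}[\mu\leftharpoonup\lambda]\; s_\lambda. $$
   Context: $\mathbf N=\{0,1,2,\ldots\}$. A composition is a finitely supported sequence $\alpha=(\alpha_i)_{i\in\mathbf N}$ of natural numbers; $\mathcal C$ is the set of all compositions, and $|\alpha|=\sum_i\alpha_i$. $\mathcal P_n$ is the set of partitions of $n$: compositions $\lambda$ with $|\lambda|=n$ and $\lambda_i\ge\lambda_{i+1}$ for all $i$. Finite vectors are extended by zeros, so $\mathbf N^n\subset\mathcal C$. The Iverson bracket $[\text{condition}]$ is $1$ if the condition holds and $0$ otherwise. For partitions $\mu,\lambda$, the relation $\mu\leftharpoonup\lambda$ ("$\lambda/\mu$ is a vertical strip") means that $\mu_i\le\lambda_i\le\mu_i+1$ for all $i\in\mathbf N$. $\Lambda$ is the ring of symmetric functions over $\mathbf Z$ (symmetric power series of bounded degree in indeterminates $X_i$, $i\in\mathbf N$). The elementary symmetric function is $e_d=\sum_{i_1<\cdots<i_d}X_{i_1}\cdots X_{i_d}\in\Lambda$ (so $e_0=1$). Schur functions: for $\alpha\in\mathbf N^n$ put $a_\alpha[X_{[n]}]=\sum_{\sigma\in\mathbf S_n}\operatorname{sgn}(\sigma)\prod_{i=0}^{n-1}X_{\sigma(i)}^{\alpha_i}$, let $\delta_n=(n-1,\ldots,1,0)$, and set $s_\alpha[X_{[n]}]=a_{\delta_n+\alpha}[X_{[n]}]/a_{\delta_n}[X_{[n]}]$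 for $\alpha\in\mathbf N^n$ and $s_\alpha[X_{[n]}]=0$ for $\alpha\in\mathcal C\setminus\mathbf N^n$. Then $s_\alpha\in\Lambda$ is the unique symmetric function which for every $n\in\mathbf N$ becomes $s_\alpha[X_{[n]}]$ upon setting $X_i=0$ for all $i\ge n$. *)

theory Defs
  imports "HOL-Library.Poly_Mapping" "HOL-Combinatorics.Permutations"
begin

section \<open>Compositions and partitions\<close>

text \<open>
  Compositions are the finitely supported maps from nat to nat. The same type serves for the
  exponent vectors of monomials in the indeterminates \<open>X 0, X 1, \<dots>\<close>.
\<close>

type_synonym composition = "nat \<Rightarrow>\<^sub>0 nat"

abbreviation part :: "composition \<Rightarrow> nat \<Rightarrow> nat"
  where "part \<equiv> Poly_Mapping.lookup"

definition weight :: "composition \<Rightarrow> nat"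
  where "weight \<alpha> = (\<Sum>i\<in>Poly_Mapping.keys \<alpha>. part \<alpha> i)"

definition partitions :: "nat \<Rightarrow> composition set"
  where "partitions n = {\<nu>. weight \<nu> = n \<and> (\<forall>i. part \<nu> i \<ge> part \<nu> (Suc i))}"

definition vertical_strip :: "composition \<Rightarrow> composition \<Rightarrow> bool"
  where "vertical_strip \<mu> \<nu> \<longleftrightarrow> (\<forall>i. part \<mu> i \<le> part \<nu> i \<and> part \<nu> i \<le> part \<mu> i + 1)"

lemma weight_eq_sum:
  assumes "finite A" "Poly_Mapping.keys \<alpha> \<subseteq> A"
  shows "weight \<alpha> = (\<Sum>i\<in>A. part \<alpha> i)"
  unfolding weight_def
  by (rule sum.mono_neutral_left) (use assms in \<open>auto simp: in_keys_iff\<close>)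

lemma weight_add: "weight (\<alpha> + \<beta>) = weight \<alpha> + weight \<beta>"
proof -
  let ?A = "Poly_Mapping.keys \<alpha> \<union> Poly_Mapping.keys \<beta>"
  have "Poly_Mapping.keys (\<alpha> + \<beta>) \<subseteq> ?A"
    by (rule Poly_Mapping.keys_add)
  then show ?thesis
    by (simp add: weight_eq_sum[of ?A] lookup_add sum.distrib)
qed

lemma part_le_weight: "part \<alpha> i \<le> weight \<alpha>"
  by (cases "i \<in> Poly_Mapping.keys \<alpha>") (auto simp: weight_def in_keys_iff intro: member_le_sum)

lemma finite_bounded_compositions:
  assumes "finite A"
  shows "finite {\<alpha>. Poly_Mapping.keys \<alpha> \<subseteq> A \<and> (\<forall>i. part \<alpha> i \<le> k)}"
    (is "finite ?S")
proof -
  have "finite {f. \<forall>i. (i \<in> A \<longrightarrow> f i \<in> {..k}) \<and> (i \<notin> A \<longrightarrow> f i = (0::nat))}"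
    by (rule finite_set_of_finite_funs) (use assms in auto)
  moreover have "part ` ?S \<subseteq> {f. \<forall>i. (i \<in> A \<longrightarrow> f i \<in> {..k}) \<and> (i \<notin> A \<longrightarrow> f i = 0)}"
    by (auto simp: subset_eq in_keys_iff)
  ultimately have "finite (part ` ?S)"
    by (rule finite_subset[rotated])
  then show ?thesis
    by (rule finite_imageD) (auto intro: inj_onI poly_mapping_eqI)
qed

lemma finite_partitions: "finite (partitions n)"
proof (rule finite_subset)
  show "partitions n \<subseteq> {\<alpha>. Poly_Mapping.keys \<alpha> \<subseteq> {..n} \<and> (\<forall>i. part \<alpha> i \<le> n)}"
  proof (clarify, rule conjI)
    fix \<nu> assume l: "\<nu> \<in> partitions n"
    then have w: "weight \<nu> = n" and dec: "part \<nu> (Suc i) \<le> part \<nu> i" for i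
      by (auto simp: partitions_def)
    show "Poly_Mapping.keys \<nu> \<subseteq> {..n}"
    proof
      fix i assume "i \<in> Poly_Mapping.keys \<nu>"
      then have pos: "part \<nu> j \<ge> 1" if "j \<le> i" for j
        using lift_Suc_antimono_le[of "part \<nu>", OF dec that] by (simp add: in_keys_iff)
      have "Suc i = (\<Sum>j\<le>i. 1)" by simp
      also have "\<dots> \<le> (\<Sum>j\<le>i. part \<nu> j)"
        by (rule sum_mono) (use pos in auto)
      also have "\<dots> \<le> (\<Sum>j\<in>{..i} \<union> Poly_Mapping.keys \<nu>. part \<nu> j)"
        by (rule sum_mono2) auto
      also have "\<dots> = n"
        using weight_eq_sum[of "{..i} \<union> Poly_Mapping.keys \<nu>" \<nu>] w by simp
      finally show "i \<in> {..n}" by simp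
    qed
    show "\<forall>i. part \<nu> i \<le> n"
      using part_le_weight w by metis
  qed
qed (rule finite_bounded_compositions, simp)


section \<open>The ring of symmetric functions\<close>

text \<open>
  A power series is given by its coefficients, as a function on exponent vectors. Bounded degree
  means that the weights of the occurring monomials are bounded. For a bijection \<open>\<pi>\<close> of the
  index set, \<open>Poly_Mapping.map_key \<pi> m\<close> is the exponent vector \<open>m \<circ> \<pi>\<close>.
\<close>

definition bounded_degree :: "(composition \<Rightarrow> int) \<Rightarrow> bool"
  where "bounded_degree f \<longleftrightarrow> (\<exists>k. \<forall>m. f m \<noteq> 0 \<longrightarrow> weight m \<le> k)"

definition symmetric :: "(composition \<Rightarrow> int) \<Rightarrow> bool"
  where "symmetric f \<longleftrightarrow> (\<forall>\<pi> m. bij \<pi> \<longrightarrow> f (Poly_Mapping.map_key \<pi> m) = f m)"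

definition cauchy_prod :: "(composition \<Rightarrow> int) \<Rightarrow> (composition \<Rightarrow> int) \<Rightarrow> composition \<Rightarrow> int"
  where "cauchy_prod f g m = (\<Sum>(a, b)\<in>{(a, b). a + b = m}. f a * g b)"

lemma finite_splits: "finite {(a, b). a + b = (m :: composition)}"
proof (rule finite_subset)
  let ?S = "{\<alpha>. Poly_Mapping.keys \<alpha> \<subseteq> Poly_Mapping.keys m \<and> (\<forall>i. part \<alpha> i \<le> weight m)}"
  show "{(a, b). a + b = m} \<subseteq> ?S \<times> ?S"
    by (auto simp: in_keys_iff lookup_add weight_add
          intro: trans_le_add1[OF part_le_weight] trans_le_add2[OF part_le_weight])
  show "finite (?S \<times> ?S)"
    by (intro finite_cartesian_product finite_bounded_compositions) auto
qed

lemma cauchy_prod_commute: "cauchy_prod f g = cauchy_prod g f"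
  unfolding cauchy_prod_def fun_eq_iff
  by (intro allI sum.reindex_bij_witness[of _ prod.swap prod.swap]) (auto simp: add.commute)

lemma cauchy_prod_assoc:
  "cauchy_prod (cauchy_prod f g) h = cauchy_prod f (cauchy_prod g h)"
proof
  fix m
  let ?D = "\<lambda>m. {(a, b). a + b = (m :: composition)}"
  have "cauchy_prod (cauchy_prod f g) h m
      = (\<Sum>p\<in>?D m. \<Sum>q\<in>?D (fst p). f (fst q) * g (snd q) * h (snd p))"
    by (simp add: cauchy_prod_def case_prod_unfold sum_distrib_right)
  also have "\<dots> = (\<Sum>(p, q)\<in>Sigma (?D m) (\<lambda>p. ?D (fst p)). f (fst q) * g (snd q) * h (snd p))"
    by (rule sum.Sigma) (auto intro: finite_splits)
  also have "\<dots> = (\<Sum>(p, q)\<in>Sigma (?D m) (\<lambda>p. ?D (snd p)). f (fst p) * (g (fst q) * h (snd q)))"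
    by (rule sum.reindex_bij_witness
          [of _ "\<lambda>((a, bc), (b, c)). ((a + b, c), (a, b))" "\<lambda>((ab, c), (a, b)). ((a, b + c), (b, c))"])
       (auto simp: add.assoc mult.assoc)
  also have "\<dots> = (\<Sum>p\<in>?D m. \<Sum>q\<in>?D (snd p). f (fst p) * (g (fst q) * h (snd q)))"
    by (rule sum.Sigma[symmetric]) (auto intro: finite_splits)
  also have "\<dots> = cauchy_prod f (cauchy_prod g h) m"
    by (simp add: cauchy_prod_def case_prod_unfold sum_distrib_left)
  finally show "cauchy_prod (cauchy_prod f g) h m = cauchy_prod f (cauchy_prod g h) m" .
qed

lemma cauchy_prod_one: "cauchy_prod (\<lambda>m. of_bool (m = 0)) f = f"
proof
  fix m
  have "(\<Sum>(a, b)\<in>{(a, b). a + b = m}. of_bool (a = 0) * f b)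
      = (\<Sum>(a, b)\<in>{(0 :: composition, m)}. of_bool (a = 0) * f b)"
    by (rule sum.mono_neutral_right[OF finite_splits]) auto
  then show "cauchy_prod (\<lambda>m. of_bool (m = 0)) f m = f m"
    by (simp add: cauchy_prod_def)
qed

lemma map_key_bij_cancel:
  fixes \<pi> :: "nat \<Rightarrow> nat" and m :: composition
  assumes "bij \<pi>"
  shows "Poly_Mapping.map_key (inv \<pi>) (Poly_Mapping.map_key \<pi> m) = m"
    and "Poly_Mapping.map_key \<pi> (Poly_Mapping.map_key (inv \<pi>) m) = m"
  using assms
  by (auto intro!: poly_mapping_eqI
        simp: map_key.rep_eq bij_is_inj bij_imp_bij_inv bij_inv_eq_iff surj_f_inv_f bij_is_surj)

lemma weight_map_key:
  assumes "bij \<pi>"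
  shows "weight (Poly_Mapping.map_key \<pi> m) = weight m"
proof -
  have "weight (Poly_Mapping.map_key \<pi> m)
      = (\<Sum>i\<in>\<pi> -` Poly_Mapping.keys m. part m (\<pi> i))"
    using assms by (simp add: weight_def keys_map_key map_key.rep_eq bij_is_inj)
  also have "\<dots> = weight m"
    unfolding weight_def
    by (rule sum.reindex_bij_witness[of _ "inv \<pi>" \<pi>])
       (use assms in \<open>auto simp: bij_is_inj bij_is_surj surj_f_inv_f\<close>)
  finally show ?thesis .
qed

lemma map_key_splits:
  fixes \<pi> :: "nat \<Rightarrow> nat" and a b m :: composition
  assumes "bij \<pi>"
  shows "Poly_Mapping.map_key \<pi> a + Poly_Mapping.map_key \<pi> b = Poly_Mapping.map_key \<pi> m
         \<longleftrightarrow> a + b = m"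
  using assms map_key_bij_cancel[OF assms] map_key_plus[OF bij_is_inj[OF assms]] by metis

lemma symmetric_cauchy_prod:
  assumes "symmetric f" "symmetric g"
  shows "symmetric (cauchy_prod f g)"
  unfolding symmetric_def
proof (intro allI impI)
  fix \<pi> :: "nat \<Rightarrow> nat" and m assume pi: "bij \<pi>"
  show "cauchy_prod f g (Poly_Mapping.map_key \<pi> m) = cauchy_prod f g m"
    unfolding cauchy_prod_def
  proof (rule sum.reindex_bij_witness
      [of _ "map_prod (Poly_Mapping.map_key \<pi>) (Poly_Mapping.map_key \<pi>)"
            "map_prod (Poly_Mapping.map_key (inv \<pi>)) (Poly_Mapping.map_key (inv \<pi>))"])
    fix p assume "p \<in> {(a, b). a + b = Poly_Mapping.map_key \<pi> m}"
    then show "map_prod (Poly_Mapping.map_key (inv \<pi>)) (Poly_Mapping.map_key (inv \<pi>)) p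
                \<in> {(a, b). a + b = m}"
      by (auto simp: map_key_bij_cancel(1)[OF pi]
            simp flip: map_key_plus[OF bij_is_inj[OF bij_imp_bij_inv[OF pi]]])
  next
    fix p
    show "(case map_prod (Poly_Mapping.map_key (inv \<pi>)) (Poly_Mapping.map_key (inv \<pi>)) p of
             (a, b) \<Rightarrow> f a * g b) = (case p of (a, b) \<Rightarrow> f a * g b)"
      using assms bij_imp_bij_inv[OF pi] by (cases p) (auto simp: symmetric_def)
  qed (auto simp: map_key_bij_cancel pi map_key_splits)
qed

lemma bounded_degree_cauchy_prod:
  assumes "bounded_degree f" "bounded_degree g"
  shows "bounded_degree (cauchy_prod f g)"
proof -
  from assms obtain k l where k: "\<And>m. f m \<noteq> 0 \<Longrightarrow> weight m \<le> k"
    and l: "\<And>m. g m \<noteq> 0 \<Longrightarrow> weight m \<le> l"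
    by (auto simp: bounded_degree_def)
  have "weight m \<le> k + l" if nz: "cauchy_prod f g m \<noteq> 0" for m
  proof -
    obtain p where "p \<in> {(a, b). a + b = m}" "(case p of (a, b) \<Rightarrow> f a * g b) \<noteq> 0"
      using nz unfolding cauchy_prod_def by (rule sum.not_neutral_contains_not_neutral)
    then obtain a b where ab: "a + b = m" "f a \<noteq> 0" "g b \<noteq> 0" by auto
    then show ?thesis using k[of a] l[of b] weight_add[of a b] by simp
  qed
  then show ?thesis unfolding bounded_degree_def by blast
qed

typedef symfun = "{f. bounded_degree f \<and> symmetric f}"
  morphisms coeff Symfun
  by (rule exI[of _ "\<lambda>_. 0"]) (simp add: bounded_degree_def symmetric_def)

setup_lifting type_definition_symfun

instantiation symfun :: comm_ring_1
begin

lift_definition zero_symfun :: symfun is "\<lambda>_. 0"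
  by (simp add: bounded_degree_def symmetric_def)

lift_definition one_symfun :: symfun is "\<lambda>m. of_bool (m = 0)"
proof
  have "Poly_Mapping.map_key \<pi> m = 0 \<longleftrightarrow> m = 0" if "bij \<pi>"
    for \<pi> :: "nat \<Rightarrow> nat" and m :: composition
    using map_key_bij_cancel[OF that] map_key_zero[OF bij_is_inj] that bij_imp_bij_inv by metis
  then show "symmetric (\<lambda>m. of_bool (m = 0))" by (simp add: symmetric_def)
qed (auto simp: bounded_degree_def weight_def)

lift_definition plus_symfun :: "symfun \<Rightarrow> symfun \<Rightarrow> symfun" is "\<lambda>f g m. f m + g m"
proof -
  fix f g :: "composition \<Rightarrow> int"
  assume f: "bounded_degree f \<and> symmetric f" and g: "bounded_degree g \<and> symmetric g"
  from f g obtain k l where "\<And>m. f m \<noteq> 0 \<Longrightarrow> weight m \<le> k" "\<And>m. g m \<noteq> 0 \<Longrightarrow> weight m \<le> l"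
    by (auto simp: bounded_degree_def)
  then have "\<forall>m. f m + g m \<noteq> 0 \<longrightarrow> weight m \<le> max k l"
    by (metis add_0 max.coboundedI1 max.coboundedI2)
  with f g show "bounded_degree (\<lambda>m. f m + g m) \<and> symmetric (\<lambda>m. f m + g m)"
    unfolding bounded_degree_def symmetric_def by auto
qed

lift_definition uminus_symfun :: "symfun \<Rightarrow> symfun" is "\<lambda>f m. - f m"
  by (simp add: bounded_degree_def symmetric_def)

definition minus_symfun :: "symfun \<Rightarrow> symfun \<Rightarrow> symfun"
  where "minus_symfun f g = f + - g"

lift_definition times_symfun :: "symfun \<Rightarrow> symfun \<Rightarrow> symfun" is cauchy_prod
  using bounded_degree_cauchy_prod symmetric_cauchy_prod by auto

instance
proof
  fix a b c :: symfun
  show "a + b + c = a + (b + c)" "a + b = b + a" "0 + a = a" "- a + a = 0"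
    by (transfer; simp add: fun_eq_iff)+
  show "a - b = a + - b" by (rule minus_symfun_def)
  show "a * b * c = a * (b * c)" by transfer (rule cauchy_prod_assoc)
  show "a * b = b * a" by transfer (rule cauchy_prod_commute)
  show "1 * a = a" by transfer (rule cauchy_prod_one)
  show "(a + b) * c = a * c + b * c"
    by transfer (simp add: cauchy_prod_def fun_eq_iff case_prod_unfold distrib_right sum.distrib)
  show "(0 :: symfun) \<noteq> 1"
    by transfer (auto simp: fun_eq_iff)
qed

end


section \<open>Elementary symmetric functions\<close>

text \<open>
  Increasing index sequences of length \<open>d\<close> correspond to index sets of size \<open>d\<close>; the coefficient
  at \<open>m\<close> counts those whose product of indeterminates is the monomial with exponent vector \<open>m\<close>.
\<close>

lift_definition elementary :: "nat \<Rightarrow> symfun" is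
  "\<lambda>d m. int (card {I. finite I \<and> card I = d \<and> (\<Sum>i\<in>I. Poly_Mapping.single i 1) = m})"
proof
  fix d :: nat
  define M where "M I = (\<Sum>i\<in>I. Poly_Mapping.single i (1 :: nat))" for I :: "nat set"
  let ?S = "\<lambda>m. {I. finite I \<and> card I = d \<and> M I = m}"
  have wt: "weight (M I) = card I" if "finite I" for I
    using that
    by (induction I) (auto simp: M_def weight_add, simp_all add: weight_def)
  have mk: "Poly_Mapping.map_key \<pi> (M (\<pi> ` I)) = M I" if "bij \<pi>" "finite I" for \<pi> I
    using that(2)
  proof (induction I)
    case (insert x I)
    have "\<pi> x \<notin> \<pi> ` I" using insert that(1) by (auto simp: bij_is_inj inj_eq)
    then show ?case using insert that(1)
      by (simp add: M_def map_key_plus bij_is_inj)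
  qed (simp add: M_def bij_is_inj that)
  have "card (?S (Poly_Mapping.map_key \<pi> m)) = card (?S m)" if pi: "bij \<pi>" for \<pi> m
  proof (rule bij_betw_same_card[of "image \<pi>"], rule bij_betw_byWitness[of _ "image (inv \<pi>)"])
    show "\<forall>I\<in>?S (Poly_Mapping.map_key \<pi> m). inv \<pi> ` \<pi> ` I = I"
      using pi by (simp add: image_inv_f_f bij_is_inj)
    show "\<forall>I\<in>?S m. \<pi> ` inv \<pi> ` I = I"
      using pi by (simp add: image_f_inv_f bij_is_surj)
    have "M (\<pi> ` I) = m" if "finite I" "M I = Poly_Mapping.map_key \<pi> m" for I
      using mk[OF pi that(1)] that(2) map_key_bij_cancel[OF pi] by metis
    then show "image \<pi> ` ?S (Poly_Mapping.map_key \<pi> m) \<subseteq> ?S m"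
      using card_image[OF inj_on_subset[OF bij_is_inj[OF pi] subset_UNIV]] by auto
    have "M (inv \<pi> ` I) = Poly_Mapping.map_key \<pi> (M I)" if "finite I" for I
      using mk[OF pi, of "inv \<pi> ` I"] that pi
      by (metis bij_is_surj finite_imageI image_f_inv_f map_key_bij_cancel(2))
    then show "image (inv \<pi>) ` ?S m \<subseteq> ?S (Poly_Mapping.map_key \<pi> m)"
      using card_image[OF inj_on_subset[OF bij_is_inj[OF bij_imp_bij_inv[OF pi]] subset_UNIV]]
      by auto
  qed
  then show "symmetric (\<lambda>m. int (card {I. finite I \<and> card I = d \<and>
      (\<Sum>i\<in>I. Poly_Mapping.single i 1) = m}))"
    by (simp add: symmetric_def M_def)
  have "weight m \<le> d" if "card (?S m) \<noteq> 0" for m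
  proof -
    from that have "?S m \<noteq> {}" by (metis card.empty)
    then obtain I where "finite I" "card I = d" "M I = m" by blast
    then show ?thesis using wt[of I] by simp
  qed
  then show "bounded_degree (\<lambda>m. int (card {I. finite I \<and> card I = d \<and>
      (\<Sum>i\<in>I. Poly_Mapping.single i 1) = m}))"
    by (auto simp: bounded_degree_def M_def)
qed


section \<open>Schur functions\<close>

text \<open>
  Polynomials in the indeterminates \<open>X 0, X 1, \<dots>\<close>. This ring is an integral domain, so the
  quotient of two alternants below is determined by cross-multiplication.
\<close>

type_synonym poly_int = "composition \<Rightarrow>\<^sub>0 int"

definition indet :: "nat \<Rightarrow> poly_int"
  where "indet i = Poly_Mapping.single (Poly_Mapping.single i 1) 1"

definition alternant :: "nat \<Rightarrow> composition \<Rightarrow> poly_int"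
  where "alternant n \<alpha> =
    (\<Sum>\<sigma> | \<sigma> permutes {..<n}. of_int (sign \<sigma>) * (\<Prod>i<n. indet (\<sigma> i) ^ part \<alpha> i))"

definition staircase :: "nat \<Rightarrow> composition"
  where "staircase n = (\<Sum>i<n. Poly_Mapping.single i (n - 1 - i))"

definition schur_poly :: "nat \<Rightarrow> composition \<Rightarrow> poly_int"
  where "schur_poly n \<alpha> =
    (if Poly_Mapping.keys \<alpha> \<subseteq> {..<n}
     then THE p. p * alternant n (staircase n) = alternant n (staircase n + \<alpha>)
     else 0)"

text \<open>
  Setting \<open>X i = 0\<close> for all \<open>i \<ge> n\<close> removes the monomials that involve one of these
  indeterminates; bounded degree makes the result a polynomial.
\<close>

lift_definition specialize :: "nat \<Rightarrow> symfun \<Rightarrow> poly_int" is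
  "\<lambda>n f m. if Poly_Mapping.keys m \<subseteq> {..<n} then f m else 0"
proof -
  fix n :: nat and f :: "composition \<Rightarrow> int"
  assume "bounded_degree f \<and> symmetric f"
  then obtain k where k: "\<And>m. f m \<noteq> 0 \<Longrightarrow> weight m \<le> k"
    by (auto simp: bounded_degree_def)
  have "{m. (if Poly_Mapping.keys m \<subseteq> {..<n} then f m else 0) \<noteq> 0}
      \<subseteq> {m. Poly_Mapping.keys m \<subseteq> {..<n} \<and> (\<forall>i. part m i \<le> k)}"
    using k order_trans[OF part_le_weight] by (auto split: if_splits)
  then show "finite {m. (if Poly_Mapping.keys m \<subseteq> {..<n} then f m else 0) \<noteq> 0}"
    by (rule finite_subset) (rule finite_bounded_compositions, simp)
qed

definition schur :: "composition \<Rightarrow> symfun"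
  where "schur \<alpha> = (THE s. \<forall>n. specialize n s = schur_poly n \<alpha>)"

end

theory Submission
  imports Defs
begin

text \<open>
  Multiplying the alternant \<open>a\<^bsub>\<delta> + \<mu>\<^esub>\<close> in \<open>N\<close> indeterminates by \<open>e\<^sub>d\<close> adds the indicator vectors of the
  \<open>d\<close>-element subsets of \<open>{..<N}\<close> to the exponent, and the summands that are not of the form
  \<open>\<delta>\<close> plus a partition have two equal exponents, hence vanish. This is the Pieri rule for alternants.
  Schur functions are obtained from it as well, without any divisibility or stability argument: solving
  the rule for its extremal summand expresses \<open>s\<^sub>\<nu>\<close> recursively as an element of the ring of
  symmetric functions whose specializations are the quotients of alternants. Since specializations
  jointly determine a symmetric function and alternants cancel, the rule transfers to Schur functions.
\<close>

section \<open>Specialization\<close>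

lemma specialize_zero: "specialize N 0 = 0"
  by (rule poly_mapping_eqI) (simp add: specialize.rep_eq zero_symfun.rep_eq)

lemma specialize_add: "specialize N (f + g) = specialize N f + specialize N g"
  by (rule poly_mapping_eqI) (simp add: specialize.rep_eq plus_symfun.rep_eq lookup_add)

lemma specialize_diff: "specialize N (f - g) = specialize N f - specialize N g"
  using specialize_add[of N "f - g" g] by simp

lemma specialize_sum: "specialize N (sum f A) = (\<Sum>a\<in>A. specialize N (f a))"
  by (induction A rule: infinite_finite_induct) (simp_all add: specialize_zero specialize_add)

lemma specialize_one: "specialize N 1 = 1"
  by (rule poly_mapping_eqI) (auto simp: specialize.rep_eq one_symfun.rep_eq lookup_one when_def)

text \<open>Only the finitely many splittings of \<open>m\<close> contribute to the formal sum
  defining the product, so polynomials and symmetric functions share one convolution.\<close>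

lemma lookup_times_poly_int:
  fixes p q :: poly_int
  shows "Poly_Mapping.lookup (p * q) = cauchy_prod (Poly_Mapping.lookup p) (Poly_Mapping.lookup q)"
proof
  fix m
  let ?h = "\<lambda>(a, b). (Poly_Mapping.lookup p a * Poly_Mapping.lookup q b) when m = a + b"
  have "Poly_Mapping.lookup (p * q) m = Sum_any ?h"
    by (simp add: times_poly_mapping.rep_eq prod_fun_unfold_prod)
  also have "\<dots> = sum ?h {(a, b). a + b = m}"
    by (rule Sum_any.expand_superset[OF finite_splits]) (auto simp: when_def split: if_splits)
  also have "\<dots> = cauchy_prod (Poly_Mapping.lookup p) (Poly_Mapping.lookup q) m"
    unfolding cauchy_prod_def by (rule sum.cong) auto
  finally show "Poly_Mapping.lookup (p * q) m
    = cauchy_prod (Poly_Mapping.lookup p) (Poly_Mapping.lookup q) m" .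
qed

lemma keys_add_composition:
  "Poly_Mapping.keys (\<alpha> + \<beta> :: composition) = Poly_Mapping.keys \<alpha> \<union> Poly_Mapping.keys \<beta>"
  by (auto simp: in_keys_iff lookup_add)

text \<open>Exponents are natural numbers, so supports cannot cancel: \<open>m\<close> involves only
  the first \<open>N\<close> indeterminates iff both parts of each of its splittings do.\<close>

lemma specialize_mult: "specialize N (f * g) = specialize N f * specialize N g"
proof (rule poly_mapping_eqI)
  fix m
  let ?s = "\<Sum>(a, b)\<in>{(a, b). a + b = m}. coeff f a * coeff g b"
  let ?t = "\<Sum>(a, b)\<in>{(a, b). a + b = m}.
    (if Poly_Mapping.keys a \<subseteq> {..<N} then coeff f a else 0) *
    (if Poly_Mapping.keys b \<subseteq> {..<N} then coeff g b else 0)"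
  show "Poly_Mapping.lookup (specialize N (f * g)) m = Poly_Mapping.lookup (specialize N f * specialize N g) m"
    unfolding lookup_times_poly_int specialize.rep_eq times_symfun.rep_eq cauchy_prod_def
  proof (cases "Poly_Mapping.keys m \<subseteq> {..<N}")
    case True
    then show "(if Poly_Mapping.keys m \<subseteq> {..<N} then ?s else 0) = ?t"
      by (auto intro!: sum.cong simp: keys_add_composition)
  next
    case False
    then show "(if Poly_Mapping.keys m \<subseteq> {..<N} then ?s else 0) = ?t"
      by (simp only: if_False, intro sum.neutral[symmetric]) (auto simp: keys_add_composition)
  qed
qed

text \<open>A monomial involves finitely many indeterminates, so its coefficient survives
  specialization at a large enough \<open>N\<close>.\<close>

lemma symfun_eqI:
  assumes "\<And>N. specialize N f = specialize N g"
  shows "f = g"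
proof -
  have "coeff f m = coeff g m" for m
  proof -
    \<comment> \<open>For \<open>m = 0\<close> the value of \<open>Max\<close> is unspecified, but
      the inclusion is then trivial.\<close>
    have "Poly_Mapping.keys m \<subseteq> {..<Suc (Max (Poly_Mapping.keys m))}"
      by (auto simp: less_Suc_eq_le)
    then show ?thesis
      using arg_cong[OF assms, of "\<lambda>p. Poly_Mapping.lookup p m" "Suc (Max (Poly_Mapping.keys m))"]
      by (simp add: specialize.rep_eq)
  qed
  then show ?thesis by (simp add: coeff_inject[symmetric] fun_eq_iff)
qed

section \<open>Monomials and vertical strips\<close>

definition indicator_comp :: "nat set \<Rightarrow> composition"
  where "indicator_comp I = (\<Sum>i\<in>I. Poly_Mapping.single i 1)"

lemma part_indicator_comp: "finite I \<Longrightarrow> part (indicator_comp I) i = of_bool (i \<in> I)"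
  by (simp add: indicator_comp_def lookup_sum lookup_single when_def sum.delta)

lemma keys_indicator_comp: "finite I \<Longrightarrow> Poly_Mapping.keys (indicator_comp I) = I"
  by (auto simp: in_keys_iff part_indicator_comp)

lemma weight_indicator_comp: "finite I \<Longrightarrow> weight (indicator_comp I) = card I"
  by (simp add: weight_def keys_indicator_comp part_indicator_comp)

lemma indet_power: "indet i ^ k = Poly_Mapping.single (Poly_Mapping.single i k) 1"
  by (induction k) (simp_all add: indet_def mult_single flip: single_add)

lemma prod_single_one:
  "(\<Prod>i\<in>A. Poly_Mapping.single (f i) (1 :: int)) = Poly_Mapping.single (\<Sum>i\<in>A. f i :: composition) 1"
  by (induction A rule: infinite_finite_induct) (simp_all add: mult_single)

lemma prod_indet: "(\<Prod>i\<in>I. indet i) = Poly_Mapping.single (indicator_comp I) 1"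
  unfolding indicator_comp_def indet_def by (rule prod_single_one)

text \<open>The support of \<open>indicator_comp I\<close> is \<open>I\<close>, so keeping the
  monomials in the first \<open>N\<close> indeterminates amounts to keeping the index sets inside
  \<open>{..<N}\<close>.\<close>

lemma specialize_elementary:
  "specialize N (elementary d) = (\<Sum>I | I \<subseteq> {..<N} \<and> card I = d. \<Prod>i\<in>I. indet i)"
proof (rule poly_mapping_eqI)
  fix m
  let ?S = "{I. I \<subseteq> {..<N} \<and> card I = d}"
  have split: "?S \<inter> {I. indicator_comp I = m} =
    (if Poly_Mapping.keys m \<subseteq> {..<N} then {I. finite I \<and> card I = d \<and> indicator_comp I = m} else {})"
    by (auto simp: keys_indicator_comp finite_subset[of _ "{..<N}"])
  have "Poly_Mapping.lookup (\<Sum>I\<in>?S. \<Prod>i\<in>I. indet i) m = (\<Sum>I\<in>?S. if indicator_comp I = m then 1 else 0)"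
    by (simp add: prod_indet lookup_sum lookup_single when_def eq_commute[of m])
  also have "\<dots> = int (card (?S \<inter> {I. indicator_comp I = m}))"
    by (simp add: sum.If_cases)
  also have "\<dots> = Poly_Mapping.lookup (specialize N (elementary d)) m"
    unfolding split specialize.rep_eq elementary.rep_eq indicator_comp_def[symmetric] by simp
  finally show "Poly_Mapping.lookup (specialize N (elementary d)) m
      = Poly_Mapping.lookup (\<Sum>I\<in>?S. \<Prod>i\<in>I. indet i) m" ..
qed

text \<open>Here \<open>I\<close> is the set of rows that gain a box. This links the strips of the
  theorem to the index sets in the expansion of \<open>elementary d\<close>.\<close>

lemma vertical_strip_weight_iff:
  "vertical_strip \<mu> \<nu> \<and> weight \<nu> = weight \<mu> + d
    \<longleftrightarrow> (\<exists>I. finite I \<and> card I = d \<and> \<nu> = \<mu> + indicator_comp I)" (is "?L \<longleftrightarrow> ?R")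
proof
  assume L: ?L
  define I where "I = {i. part \<nu> i = part \<mu> i + 1}"
  have fin: "finite I"
    by (rule finite_subset[of _ "Poly_Mapping.keys \<nu>"]) (auto simp: I_def in_keys_iff)
  have eq: "\<nu> = \<mu> + indicator_comp I"
  proof (rule poly_mapping_eqI)
    fix i
    have "part \<mu> i \<le> part \<nu> i" "part \<nu> i \<le> part \<mu> i + 1"
      using L by (auto simp: vertical_strip_def)
    then show "part \<nu> i = part (\<mu> + indicator_comp I) i"
      by (auto simp: lookup_add part_indicator_comp[OF fin]) (auto simp: I_def)
  qed
  then have "card I = d"
    using L weight_add[of \<mu> "indicator_comp I"] by (simp add: weight_indicator_comp fin)
  with eq fin show ?R by blast
next
  assume ?R
  then show ?L
    by (auto simp: vertical_strip_def weight_add weight_indicator_comp lookup_add part_indicator_comp)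
qed

section \<open>Alternants\<close>

text \<open>Composing each permutation with the transposition of \<open>i\<close> and
  \<open>j\<close> preserves the monomial and flips the sign, so the alternant equals its own
  negative.\<close>

lemma alternant_eq_0:
  assumes ij: "i < N" "j < N" "i \<noteq> j" and eq: "part \<alpha> i = part \<alpha> j"
  shows "alternant N \<alpha> = 0"
proof -
  let ?t = "Transposition.transpose i j"
  let ?f = "\<lambda>\<sigma>. of_int (sign \<sigma>) * (\<Prod>k<N. indet (\<sigma> k) ^ part \<alpha> k)"
  have t: "?t permutes {..<N}"
    using ij by (simp add: permutes_swap_id)
  have "alternant N \<alpha> = (\<Sum>\<sigma> | \<sigma> permutes {..<N}. ?f (\<sigma> \<circ> ?t))"
    unfolding alternant_def by (rule sum_permutations_compose_right[OF t])
  also have "\<dots> = (\<Sum>\<sigma> | \<sigma> permutes {..<N}. - ?f \<sigma>)"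
  proof (rule sum.cong[OF refl])
    fix \<sigma> assume "\<sigma> \<in> {\<sigma>. \<sigma> permutes {..<N}}"
    then have sgn: "sign (\<sigma> \<circ> ?t) = - sign \<sigma>"
      using ij t by (subst sign_compose) (auto simp: sign_swap_id intro: permutation_permutes[THEN iffD2])
    have "(\<Prod>k<N. indet ((\<sigma> \<circ> ?t) k) ^ part \<alpha> k) = (\<Prod>k<N. indet (\<sigma> (?t k)) ^ part \<alpha> (?t k))"
      using eq by (intro prod.cong) (auto simp: Transposition.transpose_def)
    also have "\<dots> = (\<Prod>k<N. indet (\<sigma> k) ^ part \<alpha> k)"
      using prod.permute[OF t, of "\<lambda>k. indet (\<sigma> k) ^ part \<alpha> k"] by (simp add: comp_def)
    finally show "?f (\<sigma> \<circ> ?t) = - ?f \<sigma>" by (simp add: sgn)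
  qed
  also have "\<dots> = - alternant N \<alpha>"
    by (simp add: alternant_def sum_negf)
  \<comment> \<open>Passing to coefficients reduces the claim to integers, where
    \<open>x = - x\<close> forces \<open>x = 0\<close>.\<close>
  finally have "Poly_Mapping.lookup (alternant N \<alpha>) m = - Poly_Mapping.lookup (alternant N \<alpha>) m" for m
    by (metis lookup_uminus)
  then have "Poly_Mapping.lookup (alternant N \<alpha>) m = 0" for m
    by (metis equal_neg_zero)
  then show ?thesis by (intro poly_mapping_eqI) simp
qed

lemma part_staircase: "part (staircase N) i = (if i < N then N - 1 - i else 0)"
  by (simp add: staircase_def lookup_sum lookup_single when_def sum.delta)

text \<open>The staircase has distinct entries on \<open>{..<N}\<close>, so only the identity
  permutation produces the monomial with exponent \<open>staircase N\<close>, and its coefficient is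
  1.\<close>

lemma alternant_staircase_nonzero: "alternant N (staircase N) \<noteq> 0"
proof -
  let ?e = "\<lambda>\<sigma>. \<Sum>i<N. Poly_Mapping.single (\<sigma> i) (part (staircase N) i)"
  have eq: "?e \<sigma> = staircase N \<longleftrightarrow> \<sigma> = id" if p: "\<sigma> permutes {..<N}" for \<sigma>
  proof
    assume e: "?e \<sigma> = staircase N"
    have "\<sigma> i = i" if i: "i < N" for i
    proof -
      have "part (?e \<sigma>) (\<sigma> i) = part (staircase N) i"
        using i permutes_inj[OF p] by (simp add: lookup_sum lookup_single when_def inj_eq sum.delta)
      then have "part (staircase N) (\<sigma> i) = part (staircase N) i" by (simp add: e)
      moreover have "\<sigma> i < N" using permutes_in_image[OF p] i by auto
      ultimately show ?thesis using i by (simp add: part_staircase)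
    qed
    then show "\<sigma> = id" using permutes_not_in[OF p] by (auto simp: fun_eq_iff)
  next
    assume "\<sigma> = id"
    then show "?e \<sigma> = staircase N"
      by (intro poly_mapping_eqI) (simp add: lookup_sum lookup_single when_def part_staircase sum.delta)
  qed
  have "alternant N (staircase N) = (\<Sum>\<sigma> | \<sigma> permutes {..<N}. Poly_Mapping.single (?e \<sigma>) (sign \<sigma>))"
    unfolding alternant_def indet_power prod_single_one
    by (intro sum.cong) (auto simp: mult_single simp flip: single_of_int)
  then have "Poly_Mapping.lookup (alternant N (staircase N)) (staircase N)
      = (\<Sum>\<sigma> | \<sigma> permutes {..<N}. if \<sigma> = id then 1 else 0)"
    by (auto simp: lookup_sum lookup_single when_def eq intro!: sum.cong)
  also have "\<dots> = 1"
    by (simp add: sum.delta finite_permutations permutes_id)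
  finally show ?thesis by auto
qed

text \<open>By symmetry, the elementary polynomial may be written in the permuted indeterminates
  separately in each summand of the alternant; multiplying then adds indicator vectors to
  \<open>\<beta>\<close>.\<close>

lemma elementary_times_alternant:
  "specialize N (elementary d) * alternant N \<beta>
    = (\<Sum>I | I \<subseteq> {..<N} \<and> card I = d. alternant N (\<beta> + indicator_comp I))"
proof -
  let ?S = "{I. I \<subseteq> {..<N} \<and> card I = d}"
  let ?P = "{\<sigma>. \<sigma> permutes {..<N}}"
  have e: "specialize N (elementary d) = (\<Sum>I\<in>?S. \<Prod>i\<in>I. indet (\<sigma> i))" if p: "\<sigma> \<in> ?P" for \<sigma>
  proof -
    have p: "\<sigma> permutes {..<N}" using p by simp
    have i: "inj \<sigma>" "inj (inv \<sigma>)" using permutes_inj[OF p] permutes_inj[OF permutes_inv[OF p]] by auto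
    have sub: "\<tau> ` I \<subseteq> {..<N}" if "\<tau> permutes {..<N}" "I \<subseteq> {..<N}" for \<tau> I
      using that permutes_image by blast
    show ?thesis unfolding specialize_elementary
    proof (rule sum.reindex_bij_witness[of _ "image \<sigma>" "image (inv \<sigma>)"])
      fix I assume I: "I \<in> ?S"
      show "\<sigma> ` inv \<sigma> ` I = I" "inv \<sigma> ` \<sigma> ` I = I"
        using permutes_inverses[OF p] by (auto simp: image_image)
      show "inv \<sigma> ` I \<in> ?S" "\<sigma> ` I \<in> ?S"
        using I sub[OF p] sub[OF permutes_inv[OF p]] i
        by (simp_all add: card_image inj_on_subset)
      show "(\<Prod>k\<in>inv \<sigma> ` I. indet (\<sigma> k)) = (\<Prod>i\<in>I. indet i)"
        using i permutes_inverses[OF p] by (simp add: prod.reindex inj_on_subset)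
    qed
  qed
  have m: "(\<Prod>i\<in>I. indet (\<sigma> i)) * (\<Prod>i<N. indet (\<sigma> i) ^ part \<beta> i)
     = (\<Prod>i<N. indet (\<sigma> i) ^ part (\<beta> + indicator_comp I) i)" if "I \<in> ?S" for I and \<sigma> :: "nat \<Rightarrow> nat"
  proof -
    have I: "I \<subseteq> {..<N}" "finite I" using that finite_subset by auto
    have "(\<Prod>i\<in>I. indet (\<sigma> i)) = (\<Prod>i<N. indet (\<sigma> i) ^ of_bool (i \<in> I))"
      using I by (intro prod.mono_neutral_cong_left) auto
    then show ?thesis
      using I by (simp add: lookup_add part_indicator_comp power_add mult.commute flip: prod.distrib)
  qed
  have "specialize N (elementary d) * alternant N \<beta>
      = (\<Sum>\<sigma>\<in>?P. of_int (sign \<sigma>) * (specialize N (elementary d) * (\<Prod>i<N. indet (\<sigma> i) ^ part \<beta> i)))"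
    by (simp add: alternant_def sum_distrib_left mult.left_commute)
  also have "\<dots> = (\<Sum>\<sigma>\<in>?P. \<Sum>I\<in>?S. of_int (sign \<sigma>) * (\<Prod>i<N. indet (\<sigma> i) ^ part (\<beta> + indicator_comp I) i))"
  proof (rule sum.cong[OF refl])
    fix \<sigma> assume s: "\<sigma> \<in> ?P"
    show "of_int (sign \<sigma>) * (specialize N (elementary d) * (\<Prod>i<N. indet (\<sigma> i) ^ part \<beta> i))
      = (\<Sum>I\<in>?S. of_int (sign \<sigma>) * (\<Prod>i<N. indet (\<sigma> i) ^ part (\<beta> + indicator_comp I) i))"
      unfolding e[OF s] sum_distrib_right sum_distrib_left
      by (intro sum.cong refl arg_cong[of _ _ "(*) _"] m)
  qed
  also have "\<dots> = (\<Sum>I\<in>?S. alternant N (\<beta> + indicator_comp I))"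
    unfolding alternant_def by (rule sum.swap)
  finally show ?thesis .
qed

text \<open>The value of \<open>s\<^sub>\<alpha> a\<^sub>\<delta>\<close> in \<open>N\<close> indeterminates.\<close>

definition shifted_alternant :: "nat \<Rightarrow> composition \<Rightarrow> poly_int"
  where "shifted_alternant N \<alpha> =
    (if Poly_Mapping.keys \<alpha> \<subseteq> {..<N} then alternant N (staircase N + \<alpha>) else 0)"

lemma shifted_alternant_pieri:
  assumes mu: "\<mu> \<in> partitions n"
  shows "specialize N (elementary d) * shifted_alternant N \<mu>
    = (\<Sum>\<nu>\<in>{\<nu> \<in> partitions (n + d). vertical_strip \<mu> \<nu>}. shifted_alternant N \<nu>)"
proof (cases "Poly_Mapping.keys \<mu> \<subseteq> {..<N}")
  case False
  \<comment> \<open>Adding a vertical strip can only enlarge the support, so every term on the right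
    vanishes along with the left side.\<close>
  have "\<not> Poly_Mapping.keys \<nu> \<subseteq> {..<N}" if "vertical_strip \<mu> \<nu>" for \<nu>
  proof -
    have "Poly_Mapping.keys \<mu> \<subseteq> Poly_Mapping.keys \<nu>"
      using that unfolding vertical_strip_def by (metis in_keys_iff le_zero_eq subsetI)
    then show ?thesis using False by auto
  qed
  then show ?thesis using False by (auto simp: shifted_alternant_def intro!: sum.neutral[symmetric])
next
  case True
  let ?S = "{I. I \<subseteq> {..<N} \<and> card I = d}"
  let ?T = "{I \<in> ?S. \<mu> + indicator_comp I \<in> partitions (n + d)}"
  let ?V = "{\<nu> \<in> partitions (n + d). vertical_strip \<mu> \<nu>}"
  have w: "weight \<mu> = n" and dec: "part \<mu> (Suc i) \<le> part \<mu> i" for i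
    using mu by (auto simp: partitions_def)
  have fin: "finite I" if "I \<in> ?S" for I
    using that finite_subset by blast
  have zero: "alternant N (staircase N + \<mu> + indicator_comp I) = 0" if I: "I \<in> ?S - ?T" for I
  proof -
    have f: "finite I" using fin[of I] I by blast
    have "weight (\<mu> + indicator_comp I) = n + d"
      using I by (simp add: weight_add w weight_indicator_comp[OF f])
    then obtain i where i: "part (\<mu> + indicator_comp I) i < part (\<mu> + indicator_comp I) (Suc i)"
      using I by (auto simp: partitions_def not_le)
    then have s: "i \<notin> I" "Suc i \<in> I" "part \<mu> i = part \<mu> (Suc i)"
      using dec[of i] by (auto simp: lookup_add part_indicator_comp[OF f] of_bool_def split: if_splits)
    \<comment> \<open>Both positions lie in the range where the staircase drops by exactly 1; the
      box gained in row \<open>Suc i\<close> but not in row \<open>i\<close> makes the two exponents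
      equal.\<close>
    then have "Suc i < N" using I by auto
    then show ?thesis
      using s by (intro alternant_eq_0[of i N "Suc i"])
        (auto simp: lookup_add part_indicator_comp[OF f] part_staircase)
  qed
  \<comment> \<open>Partitions in \<open>?V\<close> with support outside \<open>{..<N}\<close> are
    not reached; their \<open>shifted_alternant\<close> is 0 by definition.\<close>
  have img: "(\<lambda>I. \<mu> + indicator_comp I) ` ?T = {\<nu> \<in> ?V. Poly_Mapping.keys \<nu> \<subseteq> {..<N}}"
  proof (intro equalityI subsetI)
    fix \<nu> assume "\<nu> \<in> (\<lambda>I. \<mu> + indicator_comp I) ` ?T"
    then obtain I where I: "I \<in> ?T" "\<nu> = \<mu> + indicator_comp I" by blast
    then have "vertical_strip \<mu> \<nu>"
      using vertical_strip_weight_iff[of \<mu> \<nu> d] fin[of I] by auto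
    then show "\<nu> \<in> {\<nu> \<in> ?V. Poly_Mapping.keys \<nu> \<subseteq> {..<N}}"
      using I True fin[of I] by (auto simp: keys_add_composition keys_indicator_comp)
  next
    fix \<nu> assume v: "\<nu> \<in> {\<nu> \<in> ?V. Poly_Mapping.keys \<nu> \<subseteq> {..<N}}"
    then have "vertical_strip \<mu> \<nu> \<and> weight \<nu> = weight \<mu> + d"
      using w by (auto simp: partitions_def)
    then obtain I where "finite I" "card I = d" "\<nu> = \<mu> + indicator_comp I"
      unfolding vertical_strip_weight_iff by blast
    then show "\<nu> \<in> (\<lambda>I. \<mu> + indicator_comp I) ` ?T"
      using v by (auto simp: keys_add_composition keys_indicator_comp)
  qed
  have inj: "inj_on (\<lambda>I. \<mu> + indicator_comp I) ?T"
    by (rule inj_onI) (metis (no_types, lifting) add_left_cancel fin keys_indicator_comp mem_Collect_eq)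
  have "specialize N (elementary d) * shifted_alternant N \<mu>
      = (\<Sum>I\<in>?S. alternant N (staircase N + \<mu> + indicator_comp I))"
    using True by (simp add: shifted_alternant_def elementary_times_alternant)
  also have "\<dots> = (\<Sum>I\<in>?T. alternant N (staircase N + \<mu> + indicator_comp I))"
    using zero by (intro sum.mono_neutral_right) auto
  also have "\<dots> = (\<Sum>\<nu> \<in> {\<nu> \<in> ?V. Poly_Mapping.keys \<nu> \<subseteq> {..<N}}. alternant N (staircase N + \<nu>))"
    unfolding img[symmetric] sum.reindex[OF inj] by (simp add: add.assoc comp_def)
  also have "\<dots> = (\<Sum>\<nu>\<in>?V. shifted_alternant N \<nu>)"
    by (rule sum.mono_neutral_cong_left) (auto simp: shifted_alternant_def finite_partitions)
  finally show ?thesis .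
qed

section \<open>Existence of Schur functions\<close>

text \<open>A weakly decreasing sequence stays zero once it is zero. Supports of partitions can
  therefore be compared by cardinality alone.\<close>

lemma keys_partition:
  assumes "\<nu> \<in> partitions n"
  shows "Poly_Mapping.keys \<nu> = {..<card (Poly_Mapping.keys \<nu>)}"
proof -
  have dec: "i \<in> Poly_Mapping.keys \<nu>" if "j \<in> Poly_Mapping.keys \<nu>" "i \<le> j" for i j
    using lift_Suc_antimono_le[of "part \<nu>" i j] that assms by (auto simp: partitions_def in_keys_iff)
  show ?thesis
  proof (cases "Poly_Mapping.keys \<nu> = {}")
    case False
    then have "Poly_Mapping.keys \<nu> = {..<Suc (Max (Poly_Mapping.keys \<nu>))}"
      using dec[of "Max (Poly_Mapping.keys \<nu>)"] by (auto simp: less_Suc_eq_le)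
    then show ?thesis by (metis card_lessThan)
  qed simp
qed

text \<open>This keeps the truncated subtraction in the induction measure of \<open>ex_schur\<close>
  exact, so that more parts at equal weight means a smaller measure.\<close>

lemma card_keys_le_weight: "card (Poly_Mapping.keys \<nu>) \<le> weight \<nu>"
proof -
  have "card (Poly_Mapping.keys \<nu>) = (\<Sum>i\<in>Poly_Mapping.keys \<nu>. 1)" by simp
  also have "\<dots> \<le> weight \<nu>"
    unfolding weight_def by (rule sum_mono) (auto simp: in_keys_iff)
  finally show ?thesis .
qed

text \<open>
  Removing the first column of \<open>\<nu>\<close>, of height \<open>d\<close>, gives \<open>\<mu>\<close>. In the Pieri rule for \<open>e\<^sub>d s\<^sub>\<mu>\<close>
  every summand other than \<open>s\<^sub>\<nu>\<close> belongs to a partition with more than \<open>d\<close> parts.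
\<close>

lemma ex_schur:
  assumes "\<nu> \<in> partitions n"
  shows "\<exists>s. \<forall>N. specialize N s * alternant N (staircase N) = shifted_alternant N \<nu>"
  using assms
\<comment> \<open>The order is lexicographic: \<open>\<mu>\<close> has smaller weight than
  \<open>\<nu>\<close>, and the other summands have the same weight but more parts.\<close>
proof (induction \<nu> arbitrary: n rule:
    wf_induct_rule[OF wf_measures[of "[weight, \<lambda>\<nu>. weight \<nu> - card (Poly_Mapping.keys \<nu>)]"]])
  case (1 \<nu>)
  let ?K = "Poly_Mapping.keys \<nu>"
  define d where "d = card ?K"
  have w: "weight \<nu> = n" and dec: "part \<nu> (Suc i) \<le> part \<nu> i" for i
    using "1.prems" by (auto simp: partitions_def)
  show ?case
  proof (cases "\<nu> = 0")
    case True
    then show ?thesis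
      by (intro exI[of _ 1]) (simp add: specialize_one shifted_alternant_def)
  next
    case False
    define \<mu> where "\<mu> = \<nu> - indicator_comp ?K"
    let ?V = "{\<nu>' \<in> partitions n. vertical_strip \<mu> \<nu>'}"
    have \<nu>: "\<nu> = \<mu> + indicator_comp ?K"
      by (rule poly_mapping_eqI)
        (auto simp: \<mu>_def lookup_add lookup_minus part_indicator_comp in_keys_iff)
    have wm: "weight \<mu> + d = n"
      using w arg_cong[OF \<nu>, of weight] by (simp add: weight_add weight_indicator_comp d_def)
    have vs: "vertical_strip \<mu> \<nu>"
      by (auto simp: vertical_strip_def \<mu>_def lookup_minus part_indicator_comp)
    have "d > 0" using False by (simp add: d_def card_gt_0_iff)
    have "part \<mu> (Suc i) \<le> part \<mu> i" for i
      using dec[of i]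
      by (auto simp: \<mu>_def lookup_minus part_indicator_comp in_keys_iff of_bool_def)
    then have mu: "\<mu> \<in> partitions (weight \<mu>)" by (simp add: partitions_def)
    have "\<exists>s. \<forall>N. specialize N s * alternant N (staircase N) = shifted_alternant N \<mu>"
      using "1.IH"[OF _ mu] wm \<open>d > 0\<close> w by simp
    then obtain t where t: "\<And>N. specialize N t * alternant N (staircase N) = shifted_alternant N \<mu>"
      by blast
    have "\<exists>s. \<forall>N. specialize N s * alternant N (staircase N) = shifted_alternant N \<nu>'"
      if v: "\<nu>' \<in> ?V - {\<nu>}" for \<nu>'
    proof -
      have part: "\<nu>' \<in> partitions n" and w': "weight \<nu>' = n" using v by (auto simp: partitions_def)
      have "vertical_strip \<mu> \<nu>' \<and> weight \<nu>' = weight \<mu> + d"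
        using v w' wm by simp
      then obtain I where I: "finite I" "card I = d" "\<nu>' = \<mu> + indicator_comp I"
        unfolding vertical_strip_weight_iff by blast
      have "card (Poly_Mapping.keys \<nu>') > d"
      \<comment> \<open>With at most \<open>d\<close> parts, the support of \<open>\<nu>'\<close>
        would lie in that of \<open>\<nu>\<close>. Then \<open>I\<close> is a subset of
        \<open>?K\<close> of the same size, which forces \<open>\<nu>' = \<nu>\<close>.\<close>
      proof (rule ccontr)
        assume "\<not> card (Poly_Mapping.keys \<nu>') > d"
        then have "Poly_Mapping.keys \<nu>' \<subseteq> ?K"
          using keys_partition[OF part] keys_partition[OF "1.prems"] d_def
          by (metis lessThan_subset_iff not_le)
        then have "I \<subseteq> ?K" using I by (simp add: keys_add_composition keys_indicator_comp)
        then have "I = ?K" using I by (simp add: card_subset_eq d_def)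
        then have "\<nu>' = \<nu>" using I(3) \<nu> by metis
        then show False using v by simp
      qed
      then have "n - card (Poly_Mapping.keys \<nu>') < n - card ?K"
        using card_keys_le_weight[of \<nu>'] w' d_def by linarith
      then show ?thesis
        using "1.IH"[OF _ part] w w' by simp
    qed
    then obtain S where S: "\<And>\<nu>' N. \<nu>' \<in> ?V - {\<nu>} \<Longrightarrow>
        specialize N (S \<nu>') * alternant N (staircase N) = shifted_alternant N \<nu>'"
      by metis
    \<comment> \<open>The witness is the Pieri rule for \<open>\<mu>\<close> solved for its summand
      at \<open>\<nu>\<close>.\<close>
    have "specialize N (elementary d * t - (\<Sum>\<nu>'\<in>?V - {\<nu>}. S \<nu>')) * alternant N (staircase N)
        = shifted_alternant N \<nu>" for N
    proof -
      have "specialize N (elementary d * t - (\<Sum>\<nu>'\<in>?V - {\<nu>}. S \<nu>')) * alternant N (staircase N)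
        = specialize N (elementary d) * shifted_alternant N \<mu> - (\<Sum>\<nu>'\<in>?V - {\<nu>}. shifted_alternant N \<nu>')"
        by (simp add: specialize_diff specialize_mult specialize_sum left_diff_distrib
            sum_distrib_right mult.assoc t S)
      also have "\<dots> = shifted_alternant N \<nu>"
        using "1.prems" vs
        by (simp add: shifted_alternant_pieri[OF mu] wm sum.remove[of ?V \<nu>] finite_partitions)
      finally show ?thesis .
    qed
    then show ?thesis by blast
  qed
qed

text \<open>Both definite descriptions are resolved here: the one in \<open>schur_poly\<close> is
  unique by cancelling the nonzero alternant, the one in \<open>schur\<close> by
  \<open>symfun_eqI\<close>.\<close>

lemma specialize_schur:
  assumes "\<nu> \<in> partitions n"
  shows "specialize N (schur \<nu>) * alternant N (staircase N) = shifted_alternant N \<nu>"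
proof -
  obtain s where s: "\<And>N. specialize N s * alternant N (staircase N) = shifted_alternant N \<nu>"
    using ex_schur[OF assms] by blast
  have "schur_poly N \<nu> = specialize N s" for N
  proof (cases "Poly_Mapping.keys \<nu> \<subseteq> {..<N}")
    case True
    then have "(THE p. p * alternant N (staircase N) = alternant N (staircase N + \<nu>)) = specialize N s"
      using s[of N] alternant_staircase_nonzero[of N]
      by (intro the_equality) (auto simp: shifted_alternant_def dest: mult_right_cancel)
    then show ?thesis using True by (simp add: schur_poly_def)
  next
    case False
    \<comment> \<open>The product of \<open>specialize N s\<close> with a nonzero alternant is 0, so
      \<open>specialize N s\<close> agrees with the default value 0 of
      \<open>schur_poly\<close>.\<close>
    then show ?thesis
      using s[of N] alternant_staircase_nonzero[of N] by (auto simp: schur_poly_def shifted_alternant_def)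
  qed
  then have "schur \<nu> = s"
    unfolding schur_def by (intro the_equality) (auto intro: symfun_eqI)
  then show ?thesis using s by simp
qed

theorem proposition2p3:
  fixes d n :: nat and \<mu> :: composition
  assumes "\<mu> \<in> partitions n"
  shows "elementary d * schur \<mu> =
    (\<Sum>\<nu>\<in>partitions (n + d). of_bool (vertical_strip \<mu> \<nu>) * schur \<nu>)"
proof (rule symfun_eqI)
  fix N
  let ?V = "{\<nu> \<in> partitions (n + d). vertical_strip \<mu> \<nu>}"
  \<comment> \<open>Multiplying by the staircase alternant clears the denominators of all Schur
    polynomials at once; it is cancelled again afterwards.\<close>
  have "specialize N (elementary d * schur \<mu>) * alternant N (staircase N)
      = (\<Sum>\<nu>\<in>?V. shifted_alternant N \<nu>)"
    by (simp add: specialize_mult mult.assoc specialize_schur[OF assms] shifted_alternant_pieri[OF assms])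
  also have "\<dots> = specialize N (\<Sum>\<nu>\<in>?V. schur \<nu>) * alternant N (staircase N)"
    unfolding specialize_sum sum_distrib_right
    by (intro sum.cong refl specialize_schur[symmetric, of _ "n + d"]) simp
  finally have "specialize N (elementary d * schur \<mu>) = specialize N (\<Sum>\<nu>\<in>?V. schur \<nu>)"
    by (rule mult_right_cancel[OF alternant_staircase_nonzero, THEN iffD1])
  also have "(\<Sum>\<nu>\<in>?V. schur \<nu>)
      = (\<Sum>\<nu>\<in>partitions (n + d). of_bool (vertical_strip \<mu> \<nu>) * schur \<nu>)"
    by (rule sum.mono_neutral_cong_left[OF finite_partitions]) auto
  finally show "specialize N (elementary d * schur \<mu>)
      = specialize N (\<Sum>\<nu>\<in>partitions (n + d). of_bool (vertical_strip \<mu> \<nu>) * schur \<nu>)" .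
qed

end
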